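(* If $MA_{\omega_1}(\sigma\text{-linked})$ holds, then there is no $\Psi$-like space which has property $P_3$.
   Context: $MA_{\omega_1}(\sigma\text{-linked})$ is the statement: for every $\sigma$-linked partial order $\mathcal{P}$ and every family $\mathcal{D}$ of at most $\omega_1$ dense subsets of $\mathcal{P}$ there is a filter in $\mathcal{P}$ meeting every member of $\mathcal{D}$. (A partial order is $\sigma$-linked if it is a countable union of subsets each consisting of pairwise compatible elements.) A family $\mathcal{A}\subset[\omega]^{\omega}$ of infinite subsets of $\omega$ is almost disjoint if any two distinct members have finite intersection. Given such $\mathcal{A}$, the space $X[\mathcal{A}]$ has underlying set $\omega\cup\mathcal{A}$; the points of $\omega$ are isolated, and a neighborhood base at $A\in\mathcal{A}$ is $\{(A\cup\{A\})\setminus n: n\in\omega\}$, i.e. the sets $\{A\}\cup(A\setminus\{0,\dots,n-1\})$. A topological space is $\Psi$-like if it is homeomorphic to $X[\mathcal{A}]$ for some almost disjoint $\mathcal{A}\subset[\omega]^{\omega}$. A space $X$ has property $P_3$ if it is Hausdorff and, whenever $U_0,U_1,U_2$ are open subsets of $X$ with $U_0\cap U_1\cap U_2=\emptyset$, we have $|U_i|\le\omega$ for some $i<3$.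
   Formalization: The formal theorem speaks only of uncountable Ψ-like spaces: a countable one, such as X[∅], is Hausdorff with all open sets countable, so it has property P_3 trivially. Partial orders in MA are taken to be nonempty. *)

theory Defs
  imports "HOL-Analysis.Analysis"
begin

unbundle cardinal_syntax

text \<open>
  A partial order is a carrier \<open>P\<close> with a relation \<open>r\<close> satisfying \<^const>\<open>partial_order_on\<close>;
  \<open>(p, q) \<in> r\<close> reads \<open>p \<le> q\<close>, and dense sets and filters are taken with the forcing
  convention that smaller conditions are stronger.
\<close>

definition compatible :: "'p set \<Rightarrow> ('p \<times> 'p) set \<Rightarrow> 'p \<Rightarrow> 'p \<Rightarrow> bool" where
  "compatible P r p q \<longleftrightarrow> (\<exists>s\<in>P. (s, p) \<in> r \<and> (s, q) \<in> r)"

definition sigma_linked :: "'p set \<Rightarrow> ('p \<times> 'p) set \<Rightarrow> bool" where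
  "sigma_linked P r \<longleftrightarrow>
     (\<exists>L :: nat \<Rightarrow> 'p set. P = (\<Union>n. L n) \<and> (\<forall>n. \<forall>p\<in>L n. \<forall>q\<in>L n. compatible P r p q))"

definition dense_in_order :: "'p set \<Rightarrow> ('p \<times> 'p) set \<Rightarrow> 'p set \<Rightarrow> bool" where
  "dense_in_order P r D \<longleftrightarrow> D \<subseteq> P \<and> (\<forall>p\<in>P. \<exists>d\<in>D. (d, p) \<in> r)"

definition order_filter :: "'p set \<Rightarrow> ('p \<times> 'p) set \<Rightarrow> 'p set \<Rightarrow> bool" where
  "order_filter P r G \<longleftrightarrow> G \<subseteq> P \<and> G \<noteq> {}
     \<and> (\<forall>p\<in>G. \<forall>q\<in>P. (p, q) \<in> r \<longrightarrow> q \<in> G)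
     \<and> (\<forall>p\<in>G. \<forall>q\<in>G. \<exists>s\<in>G. (s, p) \<in> r \<and> (s, q) \<in> r)"

abbreviation omega1 :: "nat set rel" where
  "omega1 \<equiv> cardSuc natLeq"

text \<open>
  A formula cannot quantify over types, so the partial orders range over those with carrier
  contained in the type \<^typ>\<open>nat set\<close>. This is no restriction: lemma
  \<open>MA_omega1_sigma_linked_any_type\<close> below yields the same conclusion for partial orders
  on an arbitrary type. Partial orders are nonempty, as usual in forcing; the axiom fails
  for the empty order, which has no (nonempty) filter.
\<close>

definition MA_omega1_sigma_linked :: bool where
  "MA_omega1_sigma_linked \<longleftrightarrow>
     (\<forall>(P :: nat set set) r \<D>.
        P \<noteq> {} \<and> partial_order_on P r \<and> sigma_linked P r
        \<and> |\<D>| \<le>o omega1 \<and> (\<forall>D\<in>\<D>. dense_in_order P r D)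
        \<longrightarrow> (\<exists>G. order_filter P r G \<and> (\<forall>D\<in>\<D>. G \<inter> D \<noteq> {})))"

lemma omega1_infinite: "\<not> finite (Field omega1)"
  using Cinfinite_cardSuc[of natLeq] natLeq_Cinfinite by (auto simp: cinfinite_def)

lemma omega1_Card_order: "Card_order omega1"
  by (simp add: cardSuc_Card_order natLeq_Card_order)

lemma omega1_le_nat_set: "omega1 \<le>o |UNIV :: nat set set|"
proof -
  have "natLeq <o |UNIV :: nat set set|"
    using ordIso_ordLess_trans[OF ordIso_symmetric[OF card_of_nat] card_of_Pow] by simp
  then show ?thesis
    by (rule cardSuc_least[OF natLeq_Card_order card_of_Card_order])
qed

lemma MA_omega1_sigma_linked_any_type:
  fixes P :: "'q set"
  assumes MA: "MA_omega1_sigma_linked"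
    and ne: "P \<noteq> {}" and po: "partial_order_on P r" and sl: "sigma_linked P r"
    and card: "|\<D>| \<le>o omega1" and dense: "\<And>D. D \<in> \<D> \<Longrightarrow> dense_in_order P r D"
  shows "\<exists>G. order_filter P r G \<and> (\<forall>D\<in>\<D>. G \<inter> D \<noteq> {})"
proof -
  \<comment> \<open>Loewenheim-Skolem: close a point under witnesses for compatibility and density.\<close>
  have refl: "\<And>p. p \<in> P \<Longrightarrow> (p, p) \<in> r" and tr: "\<And>p q s. (p,q) \<in> r \<Longrightarrow> (q,s) \<in> r \<Longrightarrow> (p,s) \<in> r"
    and asym: "\<And>p q. (p,q) \<in> r \<Longrightarrow> (q,p) \<in> r \<Longrightarrow> p = q"
    using partial_order_onD[OF po] by (auto simp: refl_on_def trans_def antisym_def, blast?)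
  obtain p0 where p0: "p0 \<in> P" using ne by auto
  define w where "w = (\<lambda>(p, q). if compatible P r p q then (SOME s. s \<in> P \<and> (s,p) \<in> r \<and> (s,q) \<in> r) else p)"
  define d where "d = (\<lambda>(D, p). SOME s. s \<in> D \<and> (s, p) \<in> r)"
  define Q where "Q = rec_nat {p0} (\<lambda>_ S. S \<union> w ` (S \<times> S) \<union> d ` (\<D> \<times> S))"
  have Q0: "Q 0 = {p0}" and QS: "\<And>n. Q (Suc n) = Q n \<union> w ` (Q n \<times> Q n) \<union> d ` (\<D> \<times> Q n)"
    by (simp_all add: Q_def)
  define R where "R = (\<Union>n. Q n)"
  have w: "w (p, q) \<in> P \<and> (w (p,q), p) \<in> r \<and> (w (p,q), q) \<in> r" if "compatible P r p q" for p q
    using that someI_ex[of "\<lambda>s. s \<in> P \<and> (s,p) \<in> r \<and> (s,q) \<in> r"]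
    by (auto simp: w_def compatible_def)
  have wP: "w (p, q) \<in> P" if "p \<in> P" for p q
    using that w by (cases "compatible P r p q") (auto simp: w_def)
  have d: "d (D, p) \<in> D \<and> (d (D,p), p) \<in> r" if "D \<in> \<D>" "p \<in> P" for D p
    using dense[OF that(1)] that(2) someI_ex[of "\<lambda>s. s \<in> D \<and> (s,p) \<in> r"]
    by (auto simp: d_def dense_in_order_def)
  have DP: "D \<subseteq> P" if "D \<in> \<D>" for D using dense[OF that] by (simp add: dense_in_order_def)
  have QP: "Q n \<subseteq> P" for n
  proof (induction n)
    case (Suc n)
    then show ?case using wP d DP by (fastforce simp: QS)
  qed (simp add: Q0 p0)
  have RP: "R \<subseteq> P" using QP by (auto simp: R_def)
  have Qmono: "Q m \<subseteq> Q n" if "m \<le> n" for m n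
    using that by (rule lift_Suc_mono_le[rotated]) (auto simp: QS)
  have Rw: "w (p, q) \<in> R" if pq: "p \<in> R" "q \<in> R" for p q
  proof -
    obtain m n where "p \<in> Q m" "q \<in> Q n" using pq by (auto simp: R_def)
    then have "p \<in> Q (max m n)" "q \<in> Q (max m n)"
      using Qmono[of m "max m n"] Qmono[of n "max m n"] by auto
    then have "w (p, q) \<in> Q (Suc (max m n))" by (auto simp: QS)
    then show ?thesis by (auto simp: R_def)
  qed
  have Rd: "d (D, p) \<in> R" if Dp: "D \<in> \<D>" "p \<in> R" for D p
  proof -
    obtain n where "p \<in> Q n" using Dp by (auto simp: R_def)
    then have "d (D, p) \<in> Q (Suc n)" using Dp by (auto simp: QS)
    then show ?thesis by (auto simp: R_def)
  qed
  note inf = omega1_infinite and co = omega1_Card_order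
  have Qcard: "|Q n| \<le>o omega1" for n
  proof (induction n)
    case 0
    have "Field omega1 \<noteq> {}" using inf by (metis finite.emptyI)
    then have "|{p0}| \<le>o |Field omega1|" by (rule card_of_singl_ordLeq)
    then have "|{p0}| \<le>o omega1"
      by (rule ordLeq_ordIso_trans[OF _ card_of_Field_ordIso[OF co]])
    then show ?case by (simp add: Q0)
  next
    case (Suc n)
    have "|w ` (Q n \<times> Q n)| \<le>o omega1"
      using card_of_image card_of_Times_ordLeq_infinite_Field[OF inf Suc Suc co] ordLeq_transitive by blast
    moreover have "|d ` (\<D> \<times> Q n)| \<le>o omega1"
      using card_of_image card_of_Times_ordLeq_infinite_Field[OF inf card Suc co] ordLeq_transitive by blast
    ultimately show ?case
      unfolding QS using card_of_Un_ordLeq_infinite_Field[OF inf _ _ co] Suc by blast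
  qed
  have "|UNIV :: nat set| \<le>o omega1"
    using ordIso_ordLeq_trans[OF card_of_nat] cardSuc_ordLeq[OF natLeq_Card_order] by blast
  then have "|R| \<le>o omega1"
    unfolding R_def using card_of_UNION_ordLeq_infinite_Field[OF inf co] Qcard by blast
  then have "|R| \<le>o |UNIV :: nat set set|"
    using omega1_le_nat_set ordLeq_transitive by blast
  then obtain f :: "'q \<Rightarrow> nat set" where f: "inj_on f R"
    by (auto simp flip: card_of_ordLeq)
  have feq: "f p = f q \<longleftrightarrow> p = q" if "p \<in> R" "q \<in> R" for p q
    using f that by (auto simp: inj_on_def)
  define r2 where "r2 = {(f p, f q) | p q. p \<in> R \<and> q \<in> R \<and> (p, q) \<in> r}"
  have r2: "(f p, f q) \<in> r2 \<longleftrightarrow> (p, q) \<in> r" if "p \<in> R" "q \<in> R" for p q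
    using that feq by (auto simp: r2_def)
  obtain L :: "nat \<Rightarrow> 'q set" where L: "P = (\<Union>n. L n)"
    "\<And>n p q. p \<in> L n \<Longrightarrow> q \<in> L n \<Longrightarrow> compatible P r p q"
    using sl unfolding sigma_linked_def by blast
  have "p0 \<in> R" using Q0 by (auto simp: R_def intro: exI[of _ 0])
  then have "f ` R \<noteq> {}" by auto
  moreover have "partial_order_on (f ` R) r2"
    unfolding partial_order_on_def preorder_on_def
  proof (intro conjI)
    show "r2 \<subseteq> f ` R \<times> f ` R" by (auto simp: r2_def)
    show "refl_on (f ` R) r2" using refl RP by (auto simp: refl_on_def r2)
    show "trans r2"
    proof (rule transI)
      fix x y z assume "(x,y) \<in> r2" "(y,z) \<in> r2"
      then obtain p q q' s where "x = f p" "y = f q" "y = f q'" "z = f s"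
        "p \<in> R" "q \<in> R" "q' \<in> R" "s \<in> R" "(p,q) \<in> r" "(q',s) \<in> r" by (auto simp: r2_def)
      then show "(x,z) \<in> r2" using feq tr r2 by metis
    qed
    show "antisym r2"
    proof (rule antisymI)
      fix x y assume "(x,y) \<in> r2" "(y,x) \<in> r2"
      then show "x = y" using asym feq unfolding r2_def by blast
    qed
  qed
  moreover have "sigma_linked (f ` R) r2"
    unfolding sigma_linked_def
  proof (intro exI conjI allI ballI)
    show "f ` R = (\<Union>n. f ` (L n \<inter> R))" using RP unfolding L(1) by blast
    fix n x y assume "x \<in> f ` (L n \<inter> R)" "y \<in> f ` (L n \<inter> R)"
    then obtain p q where *: "x = f p" "y = f q" "p \<in> R" "q \<in> R" "p \<in> L n" "q \<in> L n" by auto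
    then show "compatible (f ` R) r2 x y"
      using w[OF L(2)[OF *(5,6)]] Rw[OF *(3,4)] r2 unfolding compatible_def by blast
  qed
  moreover have "|(\<lambda>D. f ` (D \<inter> R)) ` \<D>| \<le>o omega1"
    using card_of_image card ordLeq_transitive by blast
  moreover have "\<forall>E\<in>(\<lambda>D. f ` (D \<inter> R)) ` \<D>. dense_in_order (f ` R) r2 E"
  proof
    fix E assume "E \<in> (\<lambda>D. f ` (D \<inter> R)) ` \<D>"
    then obtain D where D: "D \<in> \<D>" "E = f ` (D \<inter> R)" by auto
    have "\<exists>e\<in>E. (e, f p) \<in> r2" if "p \<in> R" for p
      using d[OF D(1), of p] Rd[OF D(1) that] that RP D(2) r2 by blast
    then show "dense_in_order (f ` R) r2 E" using D by (auto simp: dense_in_order_def)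
  qed
  ultimately obtain G2 where G2: "order_filter (f ` R) r2 G2"
      "\<forall>E\<in>(\<lambda>D. f ` (D \<inter> R)) ` \<D>. G2 \<inter> E \<noteq> {}"
    using MA unfolding MA_omega1_sigma_linked_def by meson
  define G0 where "G0 = {p \<in> R. f p \<in> G2}"
  define G where "G = {p \<in> P. \<exists>q\<in>G0. (q, p) \<in> r}"
  have G0G: "G0 \<subseteq> G" using RP refl by (auto simp: G0_def G_def)
  have G0ne: "G0 \<noteq> {}" using G2(1) by (auto simp: order_filter_def G0_def)
  have dir: "\<exists>s\<in>G0. (s,p) \<in> r \<and> (s,q) \<in> r" if "p \<in> G0" "q \<in> G0" for p q
  proof -
    have "f p \<in> G2" "f q \<in> G2" "p \<in> R" "q \<in> R" using that by (auto simp: G0_def)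
    then obtain x where x: "x \<in> G2" "(x, f p) \<in> r2" "(x, f q) \<in> r2"
      using G2(1) unfolding order_filter_def by blast
    then obtain s where "s \<in> R" "x = f s" using G2(1) by (auto simp: order_filter_def)
    then show ?thesis using x r2 \<open>p \<in> R\<close> \<open>q \<in> R\<close> by (auto simp: G0_def)
  qed
  have "order_filter P r G"
    unfolding order_filter_def
  proof (intro conjI ballI impI)
    show "G \<subseteq> P" by (auto simp: G_def)
    show "G \<noteq> {}" using G0G G0ne by auto
    show "q \<in> G" if "p \<in> G" "q \<in> P" "(p, q) \<in> r" for p q
      using that tr by (auto simp: G_def)
    show "\<exists>s\<in>G. (s, p) \<in> r \<and> (s, q) \<in> r" if pq: "p \<in> G" "q \<in> G" for p q
    proof -
      obtain p' q' where "p' \<in> G0" "q' \<in> G0" "(p',p) \<in> r" "(q',q) \<in> r" using pq by (auto simp: G_def)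
      then show ?thesis using dir[of p' q'] G0G tr by blast
    qed
  qed
  moreover have "G \<inter> D \<noteq> {}" if "D \<in> \<D>" for D
  proof -
    have "G2 \<inter> f ` (D \<inter> R) \<noteq> {}" using G2(2) that by simp
    then obtain p where "p \<in> D" "p \<in> R" "f p \<in> G2" by auto
    then show ?thesis using G0G by (auto simp: G0_def)
  qed
  ultimately show ?thesis by blast
qed

definition almost_disjoint :: "nat set set \<Rightarrow> bool" where
  "almost_disjoint \<A> \<longleftrightarrow>
     (\<forall>A\<in>\<A>. infinite A) \<and> (\<forall>A\<in>\<A>. \<forall>B\<in>\<A>. A \<noteq> B \<longrightarrow> finite (A \<inter> B))"

text \<open>The disjoint union \<open>\<omega> \<union> \<A>\<close> is modelled by the sum type.\<close>

definition Psi_nhd :: "nat set \<Rightarrow> nat \<Rightarrow> (nat + nat set) set" where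
  "Psi_nhd A n = insert (Inr A) (Inl ` (A - {..<n}))"

definition Psi_space :: "nat set set \<Rightarrow> (nat + nat set) topology" where
  "Psi_space \<A> = topology (\<lambda>U. U \<subseteq> range Inl \<union> Inr ` \<A>
     \<and> (\<forall>A. Inr A \<in> U \<longrightarrow> (\<exists>n. Psi_nhd A n \<subseteq> U)))"

lemma openin_Psi_space:
  "openin (Psi_space \<A>) U \<longleftrightarrow> U \<subseteq> range Inl \<union> Inr ` \<A>
     \<and> (\<forall>A. Inr A \<in> U \<longrightarrow> (\<exists>n. Psi_nhd A n \<subseteq> U))"
proof -
  have mono: "Psi_nhd A n \<subseteq> Psi_nhd A m" if "m \<le> n" for A m n
    using that by (auto simp: Psi_nhd_def)
  have "istopology (\<lambda>U. U \<subseteq> range Inl \<union> Inr ` \<A> \<and> (\<forall>A. Inr A \<in> U \<longrightarrow> (\<exists>n. Psi_nhd A n \<subseteq> U)))"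
    unfolding istopology_def
  proof (intro conjI allI impI)
    fix S T A
    assume S: "S \<subseteq> range Inl \<union> Inr ` \<A> \<and> (\<forall>A. Inr A \<in> S \<longrightarrow> (\<exists>n. Psi_nhd A n \<subseteq> S))"
      and T: "T \<subseteq> range Inl \<union> Inr ` \<A> \<and> (\<forall>A. Inr A \<in> T \<longrightarrow> (\<exists>n. Psi_nhd A n \<subseteq> T))"
    show "S \<inter> T \<subseteq> range Inl \<union> Inr ` \<A>" using S by blast
    assume "Inr A \<in> S \<inter> T"
    then obtain m n where "Psi_nhd A m \<subseteq> S" "Psi_nhd A n \<subseteq> T" using S T by blast
    then have "Psi_nhd A (max m n) \<subseteq> S \<inter> T"
      using mono[of m "max m n" A] mono[of n "max m n" A] by auto
    then show "\<exists>n. Psi_nhd A n \<subseteq> S \<inter> T" by blast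
  next
    fix K A
    assume K: "\<forall>U\<in>K. U \<subseteq> range Inl \<union> Inr ` \<A> \<and> (\<forall>A. Inr A \<in> U \<longrightarrow> (\<exists>n. Psi_nhd A n \<subseteq> U))"
    then show "\<Union>K \<subseteq> range Inl \<union> Inr ` \<A>" by (meson Union_least)
    assume "Inr A \<in> \<Union>K"
    then obtain U where "U \<in> K" "Inr A \<in> U" by (rule UnionE)
    then obtain n where "Psi_nhd A n \<subseteq> U" using K by meson
    then have "Psi_nhd A n \<subseteq> \<Union>K" using \<open>U \<in> K\<close> by (meson Union_upper subset_trans)
    then show "\<exists>n. Psi_nhd A n \<subseteq> \<Union>K" ..
  qed
  then show ?thesis by (simp add: Psi_space_def)
qed

lemma topspace_Psi_space: "topspace (Psi_space \<A>) = range Inl \<union> Inr ` \<A>"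
proof -
  have "openin (Psi_space \<A>) (range Inl \<union> Inr ` \<A>)"
    unfolding openin_Psi_space Psi_nhd_def by blast
  moreover have "topspace (Psi_space \<A>) \<subseteq> range Inl \<union> Inr ` \<A>"
    using openin_topspace[of "Psi_space \<A>"] unfolding openin_Psi_space by (rule conjunct1)
  ultimately show ?thesis
    by (meson openin_subset subset_antisym)
qed

lemma openin_Psi_space_singleton: "openin (Psi_space \<A>) {Inl n}"
  by (auto simp: openin_Psi_space)

lemma openin_Psi_nhd: "A \<in> \<A> \<Longrightarrow> openin (Psi_space \<A>) (Psi_nhd A n)"
  by (auto simp: openin_Psi_space Psi_nhd_def)

definition Psi_like :: "'a topology \<Rightarrow> bool" where
  "Psi_like X \<longleftrightarrow> (\<exists>\<A>. almost_disjoint \<A> \<and> X homeomorphic_space Psi_space \<A>)"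

definition property_P3 :: "'a topology \<Rightarrow> bool" where
  "property_P3 X \<longleftrightarrow> Hausdorff_space X \<and>
     (\<forall>U0 U1 U2. openin X U0 \<and> openin X U1 \<and> openin X U2 \<and> U0 \<inter> U1 \<inter> U2 = {}
        \<longrightarrow> countable U0 \<or> countable U1 \<or> countable U2)"

text \<open>
  Every countable Hausdorff space has the property for trivial reasons (and \<open>X[\<A>]\<close> is
  countable when \<open>\<A>\<close> is), so nonexistence results must be restricted to uncountable spaces.
\<close>

lemma property_P3_countable:
  "countable (topspace X) \<Longrightarrow> Hausdorff_space X \<Longrightarrow> property_P3 X"
  unfolding property_P3_def by (meson countable_subset openin_subset)

end

theory Submission
  imports Defs "HOL-Library.Countable_Set_Type"
begin

text \<open>
  Split \<open>\<aleph>\<^sub>1\<close> many members of the almost disjoint family into three uncountable colour classes.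
  A condition \<open>(n, S, F)\<close> decides below \<open>n\<close>, by \<open>S\<close>, three sets \<open>V 0, V 1, V 2\<close> with empty
  intersection, and promises that from \<open>n\<close> on every \<open>A\<close> in the finite set \<open>F\<close> is contained in
  the \<open>V i\<close> of its colour. One demands that members of \<open>F\<close> of different colours meet only
  below \<open>n\<close>. Two conditions with the same \<open>n\<close> and \<open>S\<close> are then compatible: of three
  sets of different colours two come from the same condition, so no point \<open>\<ge> n\<close> lies in all
  three. Hence the order is \<open>\<sigma>\<close>-linked, and a generic filter provides three uncountable open sets
  \<open>V i \<union> {A. A has colour i}\<close> with empty intersection.
\<close>

section \<open>The forcing order and its amalgamation property\<close>

text \<open>A pair \<open>(k, i)\<close> in \<open>S\<close> codes that \<open>k\<close> belongs to
  the \<open>i\<close>-th set. Packing the three approximations into one finite set leaves only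
  countably many stems \<open>(n, S)\<close>.\<close>

definition tri_conditions ::
    "nat set set \<Rightarrow> (nat set \<Rightarrow> nat) \<Rightarrow> (nat \<times> (nat \<times> nat) set \<times> nat set set) set" where
  "tri_conditions \<B> c = {(n, S, F). S \<subseteq> {..<n} \<times> {..<3} \<and> (\<forall>k. \<exists>i<3. (k, i) \<notin> S)
     \<and> finite F \<and> F \<subseteq> \<B> \<and> (\<forall>A\<in>F. \<forall>B\<in>F. c A \<noteq> c B \<longrightarrow> A \<inter> B \<subseteq> {..<n})}"

text \<open>\<open>T\<close> may gain pairs below \<open>n\<close> too. The generic sets still have
  empty intersection, since any three pairs from a filter occur in one condition.\<close>

definition tri_extends ::
    "(nat set \<Rightarrow> nat) \<Rightarrow> nat \<times> (nat \<times> nat) set \<times> nat set set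
      \<Rightarrow> nat \<times> (nat \<times> nat) set \<times> nat set set \<Rightarrow> bool" where
  "tri_extends c = (\<lambda>(m, T, G) (n, S, F). n \<le> m \<and> S \<subseteq> T \<and> F \<subseteq> G
     \<and> (\<forall>A\<in>F. \<forall>k\<in>A. n \<le> k \<and> k < m \<longrightarrow> (k, c A) \<in> T))"

definition tri_order ::
    "nat set set \<Rightarrow> (nat set \<Rightarrow> nat) \<Rightarrow>
      ((nat \<times> (nat \<times> nat) set \<times> nat set set) \<times> (nat \<times> (nat \<times> nat) set \<times> nat set set)) set" where
  "tri_order \<B> c =
     {(q, p). q \<in> tri_conditions \<B> c \<and> p \<in> tri_conditions \<B> c \<and> tri_extends c q p}"

lemma tri_extends_refl: "tri_extends c p p"
  by (auto simp: tri_extends_def split: prod.splits)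

lemma tri_extends_trans:
  assumes "tri_extends c x y" "tri_extends c y z"
  shows "tri_extends c x z"
proof -
  obtain l R E m T G n S F where xyz: "x = (l, R, E)" "y = (m, T, G)" "z = (n, S, F)"
    by (metis prod_cases3)
  \<comment> \<open>Below \<open>m\<close> the middle condition has kept the promise and
    \<open>R\<close> contains \<open>T\<close>; from \<open>m\<close> on the promise passes to
    \<open>G\<close> and the strongest condition keeps it.\<close>
  have "(k, c A) \<in> R" if "A \<in> F" "k \<in> A" "n \<le> k" "k < l" for A k
    using assms that unfolding xyz tri_extends_def by (cases "k < m") auto
  then show ?thesis
    using assms unfolding xyz tri_extends_def by auto
qed

lemma partial_order_tri_order: "partial_order_on (tri_conditions \<B> c) (tri_order \<B> c)"
  unfolding partial_order_on_def preorder_on_def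
proof (intro conjI)
  show "tri_order \<B> c \<subseteq> tri_conditions \<B> c \<times> tri_conditions \<B> c"
    by (auto simp: tri_order_def)
  show "refl_on (tri_conditions \<B> c) (tri_order \<B> c)"
    by (auto simp: refl_on_def tri_order_def tri_extends_refl)
  show "trans (tri_order \<B> c)"
    by (auto simp: trans_def tri_order_def intro: tri_extends_trans)
  show "antisym (tri_order \<B> c)"
    by (auto simp: antisym_def tri_order_def tri_extends_def)
qed

text \<open>One construction serves three ends: \<open>F'\<close> arbitrary gives linkedness,
  \<open>F' = F\<close> with large \<open>l\<close> gives height, and \<open>F' = {A}\<close> adds a
  promise.\<close>

lemma tri_amalgamation:
  assumes ad: "almost_disjoint \<B>" and c: "c ` \<B> \<subseteq> {..<3}"
    and p: "(n, S, F) \<in> tri_conditions \<B> c" and p': "(n, S, F') \<in> tri_conditions \<B> c"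
  obtains m T where "l \<le> m" "(m, T, F \<union> F') \<in> tri_conditions \<B> c"
    "((m, T, F \<union> F'), (n, S, F)) \<in> tri_order \<B> c" "((m, T, F \<union> F'), (n, S, F')) \<in> tri_order \<B> c"
proof -
  define E where "E = F \<union> F'"
  have S: "S \<subseteq> {..<n} \<times> {..<3}" "\<And>k. \<exists>i<3. (k, i) \<notin> S" and E: "finite E" "E \<subseteq> \<B>"
    and F: "\<And>A B. A \<in> F \<Longrightarrow> B \<in> F \<Longrightarrow> c A \<noteq> c B \<Longrightarrow> A \<inter> B \<subseteq> {..<n}"
    and F': "\<And>A B. A \<in> F' \<Longrightarrow> B \<in> F' \<Longrightarrow> c A \<noteq> c B \<Longrightarrow> A \<inter> B \<subseteq> {..<n}"
    using p p' by (auto simp: tri_conditions_def E_def)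
  \<comment> \<open>Members of \<open>F\<close> and \<open>F'\<close> of different colours may meet
    beyond \<open>n\<close>. \<open>N\<close> collects all such points and is finite by almost
    disjointness, so the new height is taken above it.\<close>
  define N where "N = (\<Union>A\<in>E. \<Union>B\<in>{B\<in>E. A \<noteq> B}. A \<inter> B)"
  have "finite (A \<inter> B)" if "A \<in> E" "B \<in> E" "A \<noteq> B" for A B
    using that E(2) ad unfolding almost_disjoint_def by blast
  then have "finite N"
    using E(1) unfolding N_def by (intro finite_UN_I) simp_all
  then obtain b where b: "N \<subseteq> {..<b}"
    using finite_nat_iff_bounded by blast
  define m where "m = max (max n l) b"
  \<comment> \<open>The least extension of \<open>S\<close> that keeps every promise of
    \<open>E\<close> between \<open>n\<close> and \<open>m\<close>.\<close>
  define T where "T = S \<union> {(k, c A) | k A. A \<in> E \<and> k \<in> A \<and> n \<le> k \<and> k < m}"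
  have "\<exists>i<3. (k, i) \<notin> T" for k
  proof (cases "k < n")
    case True
    then show ?thesis using S(2)[of k] by (auto simp: T_def)
  next
    case False
    show ?thesis
    proof (rule ccontr)
      assume "\<not> ?thesis"
      moreover have "(k, i) \<notin> S" for i using False S(1) by auto
      ultimately have "\<exists>A\<in>E. k \<in> A \<and> c A = i" if "i < 3" for i
        using that by (auto simp: T_def)
      from this[of 0] this[of 1] this[of 2] obtain A B C where
        "A \<in> E" "B \<in> E" "C \<in> E" "k \<in> A" "k \<in> B" "k \<in> C" "c A = 0" "c B = 1" "c C = 2"
        by auto
      then have "c A \<noteq> c B" "c A \<noteq> c C" "c B \<noteq> c C" by simp_all
      \<comment> \<open>Two of \<open>A\<close>, \<open>B\<close>, \<open>C\<close> lie together in
        \<open>F\<close> or in \<open>F'\<close>, which this excludes as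
        \<open>n \<le> k\<close>.\<close>
      moreover have "c X = c Y" if "k \<in> X" "k \<in> Y" "X \<in> F \<and> Y \<in> F \<or> X \<in> F' \<and> Y \<in> F'" for X Y
        using that F[of X Y] F'[of X Y] False by auto
      ultimately show False
        using \<open>A \<in> E\<close> \<open>B \<in> E\<close> \<open>C \<in> E\<close> \<open>k \<in> A\<close> \<open>k \<in> B\<close> \<open>k \<in> C\<close> unfolding E_def by blast
    qed
  qed
  moreover have "A \<inter> B \<subseteq> {..<m}" if "A \<in> E" "B \<in> E" "c A \<noteq> c B" for A B
  proof -
    have "A \<inter> B \<subseteq> N" using that unfolding N_def by blast
    then show ?thesis using b by (auto simp: m_def)
  qed
  moreover have "T \<subseteq> {..<m} \<times> {..<3}"
    using S(1) E(2) c by (fastforce simp: T_def m_def)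
  ultimately have q: "(m, T, F \<union> F') \<in> tri_conditions \<B> c"
    using E by (simp add: tri_conditions_def E_def)
  have "tri_extends c (m, T, F \<union> F') (n, S, F)" "tri_extends c (m, T, F \<union> F') (n, S, F')"
    by (auto simp: tri_extends_def T_def m_def E_def)
  then show thesis
    using that[OF _ q] p p' q by (simp add: tri_order_def m_def)
qed

text \<open>The linked pieces are indexed by codes of stems: an equal code means an equal stem,
  which is what amalgamation asks for.\<close>

lemma sigma_linked_tri_order:
  assumes "almost_disjoint \<B>" and "c ` \<B> \<subseteq> {..<3}"
  shows "sigma_linked (tri_conditions \<B> c) (tri_order \<B> c)"
proof -
  have "countable ((UNIV :: nat set) \<times> {S :: (nat \<times> nat) set. finite S})"
    using countable_Collect_finite by (intro countable_SIGMA) auto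
  then obtain e :: "nat \<times> (nat \<times> nat) set \<Rightarrow> nat" where e: "inj_on e (UNIV \<times> {S. finite S})"
    by (rule countableE)
  define L where "L j = {(n, S, F) \<in> tri_conditions \<B> c. e (n, S) = j}" for j
  have "compatible (tri_conditions \<B> c) (tri_order \<B> c) p q" if pq: "p \<in> L j" "q \<in> L j" for j p q
  proof -
    obtain n S F n' S' F' where *: "p = (n, S, F)" "q = (n', S', F')" by (metis prod_cases3)
    then have p: "(n, S, F) \<in> tri_conditions \<B> c" "(n', S', F') \<in> tri_conditions \<B> c"
        "e (n, S) = e (n', S')"
      using pq by (auto simp: L_def)
    then have "finite S" "finite S'"
      by (auto simp: tri_conditions_def intro: finite_subset[of _ "{..<_} \<times> {..<3}"])
    then have "n' = n" "S' = S" using inj_onD[OF e p(3)] by auto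
    then obtain m T where "(m, T, F \<union> F') \<in> tri_conditions \<B> c"
        "((m, T, F \<union> F'), p) \<in> tri_order \<B> c" "((m, T, F \<union> F'), q) \<in> tri_order \<B> c"
      using tri_amalgamation[OF assms p(1), of F'] p(2) * by metis
    then show ?thesis unfolding compatible_def by blast
  qed
  moreover have "tri_conditions \<B> c = (\<Union>j. L j)" by (auto simp: L_def)
  ultimately show ?thesis unfolding sigma_linked_def by blast
qed

lemma dense_tri_height:
  assumes "almost_disjoint \<B>" and "c ` \<B> \<subseteq> {..<3}"
  shows "dense_in_order (tri_conditions \<B> c) (tri_order \<B> c) {p \<in> tri_conditions \<B> c. l \<le> fst p}"
proof -
  have "\<exists>d. d \<in> tri_conditions \<B> c \<and> l \<le> fst d \<and> (d, (n, S, F)) \<in> tri_order \<B> c"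
    if p: "(n, S, F) \<in> tri_conditions \<B> c" for n S F
    using tri_amalgamation[OF assms p p, of l] by (metis fst_conv)
  then show ?thesis by (auto simp: dense_in_order_def)
qed

lemma dense_tri_promise:
  assumes "almost_disjoint \<B>" and "c ` \<B> \<subseteq> {..<3}" and "A \<in> \<B>"
  shows "dense_in_order (tri_conditions \<B> c) (tri_order \<B> c)
    {p \<in> tri_conditions \<B> c. A \<in> snd (snd p)}"
proof -
  have "\<exists>d. d \<in> tri_conditions \<B> c \<and> A \<in> snd (snd d) \<and> (d, (n, S, F)) \<in> tri_order \<B> c"
    if p: "(n, S, F) \<in> tri_conditions \<B> c" for n S F
  proof -
    \<comment> \<open>A single promise involves one colour only, so the stem can stay the
      same.\<close>
    have "(n, S, {A}) \<in> tri_conditions \<B> c" using p assms(3) by (auto simp: tri_conditions_def)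
    from tri_amalgamation[OF assms(1,2) p this] obtain m T where
      "(m, T, F \<union> {A}) \<in> tri_conditions \<B> c" "((m, T, F \<union> {A}), (n, S, F)) \<in> tri_order \<B> c" .
    then show ?thesis by (intro exI[of _ "(m, T, F \<union> {A})"]) auto
  qed
  then show ?thesis by (auto simp: dense_in_order_def)
qed

section \<open>Three sets from a generic filter\<close>

lemma nat_le_omega1: "|UNIV :: nat set| \<le>o omega1"
  using ordIso_ordLeq_trans[OF card_of_nat] cardSuc_ordLeq[OF natLeq_Card_order] by blast

lemma MA_three_colour_separation:
  assumes MA: "MA_omega1_sigma_linked" and ad: "almost_disjoint \<B>"
    and card: "|\<B>| \<le>o omega1" and c: "c ` \<B> \<subseteq> {..<3}"
  obtains V :: "nat \<Rightarrow> nat set" where "V 0 \<inter> V 1 \<inter> V 2 = {}"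
    "\<forall>A\<in>\<B>. \<exists>n. A - {..<n} \<subseteq> V (c A)"
proof -
  let ?P = "tri_conditions \<B> c" and ?r = "tri_order \<B> c"
  \<comment> \<open>Countably many height requirements and one promise for each member of
    \<open>\<B>\<close>.\<close>
  define \<D> where "\<D> = range (\<lambda>l. {p \<in> ?P. l \<le> fst p}) \<union> (\<lambda>A. {p \<in> ?P. A \<in> snd (snd p)}) ` \<B>"
  have "|\<D>| \<le>o omega1"
    unfolding \<D>_def
    using card_of_Un_ordLeq_infinite_Field[OF omega1_infinite
        ordLeq_transitive[OF card_of_image nat_le_omega1]
        ordLeq_transitive[OF card_of_image card] omega1_Card_order] .
  moreover have "dense_in_order ?P ?r D" if "D \<in> \<D>" for D
    using that dense_tri_height[OF ad c] dense_tri_promise[OF ad c] by (auto simp: \<D>_def)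
  moreover have "(0, {}, {}) \<in> ?P" by (auto simp: tri_conditions_def intro: exI[of _ 0])
  then have "?P \<noteq> {}" by blast
  ultimately obtain G where G: "order_filter ?P ?r G" "\<And>D. D \<in> \<D> \<Longrightarrow> G \<inter> D \<noteq> {}"
    using MA_omega1_sigma_linked_any_type[OF MA _ partial_order_tri_order
        sigma_linked_tri_order[OF ad c]] by metis
  have common: "\<exists>s\<in>G. s \<in> ?P \<and> tri_extends c s p \<and> tri_extends c s q" if "p \<in> G" "q \<in> G" for p q
    using G(1) that unfolding order_filter_def tri_order_def by blast
  define V where "V i = {k. \<exists>n S F. (n, S, F) \<in> G \<and> (k, i) \<in> S}" for i
  have "k \<notin> V 0 \<inter> V 1 \<inter> V 2" for k
  proof
    assume "k \<in> V 0 \<inter> V 1 \<inter> V 2"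
    then obtain n0 S0 F0 n1 S1 F1 n2 S2 F2 where S:
      "(n0, S0, F0) \<in> G" "(k, 0) \<in> S0" "(n1, S1, F1) \<in> G" "(k, 1) \<in> S1"
      "(n2, S2, F2) \<in> G" "(k, 2) \<in> S2" by (auto simp: V_def)
    \<comment> \<open>Directedness handles two conditions at a time, so a common extension of three
      takes two rounds.\<close>
    obtain s where s: "s \<in> G" "tri_extends c s (n0, S0, F0)" "tri_extends c s (n1, S1, F1)"
      using common[OF S(1,3)] by blast
    obtain t where t: "t \<in> ?P" "tri_extends c t s" "tri_extends c t (n2, S2, F2)"
      using common[OF s(1) S(5)] by blast
    obtain m T E where tT: "t = (m, T, E)" by (metis prod_cases3)
    have "(k, 0) \<in> T" "(k, 1) \<in> T" "(k, 2) \<in> T"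
      using tri_extends_trans[OF t(2) s(2)] tri_extends_trans[OF t(2) s(3)] t(3) S
      by (auto simp: tT tri_extends_def)
    moreover have "\<exists>i<3. (k, i) \<notin> T"
      using t(1) by (simp add: tT tri_conditions_def)
    then obtain i where "i < 3" "(k, i) \<notin> T" by blast
    moreover from \<open>i < 3\<close> have "i = 0 \<or> i = 1 \<or> i = 2" by linarith
    ultimately show False by auto
  qed
  moreover have "\<exists>n. A - {..<n} \<subseteq> V (c A)" if A: "A \<in> \<B>" for A
  proof -
    have "G \<inter> {p \<in> ?P. A \<in> snd (snd p)} \<noteq> {}" using A by (intro G(2)) (auto simp: \<D>_def)
    then obtain n S F where p: "(n, S, F) \<in> G" "A \<in> F" by auto
    have "k \<in> V (c A)" if k: "k \<in> A" "n \<le> k" for k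
    proof -
      \<comment> \<open>Height at least \<open>Suc k\<close> puts \<open>k\<close> strictly below
        \<open>m\<close> in the common extension, where the promise for \<open>A\<close> must
        already be carried out.\<close>
      have "G \<inter> {p \<in> ?P. Suc k \<le> fst p} \<noteq> {}" by (intro G(2)) (auto simp: \<D>_def)
      then obtain q where q: "q \<in> G" "Suc k \<le> fst q" by blast
      obtain m T E where s: "(m, T, E) \<in> G" "tri_extends c (m, T, E) (n, S, F)"
          "tri_extends c (m, T, E) q"
        using common[OF p(1) q(1)] by (metis prod_cases3)
      then have "k < m" using q(2) by (auto simp: tri_extends_def split: prod.splits)
      then have "(k, c A) \<in> T" using s(2) p(2) k by (auto simp: tri_extends_def)
      then show ?thesis using s(1) by (auto simp: V_def)
    qed
    then show ?thesis by (intro exI[of _ n]) (simp add: subset_iff)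
  qed
  ultimately show thesis by (intro that[of V]) blast+
qed

section \<open>Cardinal arithmetic and the colouring\<close>

lemma uncountable_iff_omega1_le: "uncountable A \<longleftrightarrow> omega1 \<le>o |A|"
proof -
  have "countable A \<longleftrightarrow> |A| \<le>o natLeq"
    by (rule countable_card_le_natLeq)
  also have "\<dots> \<longleftrightarrow> \<not> natLeq <o |A|"
    using not_ordLess_iff_ordLeq[OF card_of_Well_order natLeq_Well_order] by blast
  also have "natLeq <o |A| \<longleftrightarrow> omega1 \<le>o |A|"
    by (rule cardSuc_ordLess_ordLeq[OF natLeq_Card_order card_of_Card_order])
  finally show ?thesis by blast
qed

text \<open>Three disjoint copies of \<open>omega1\<close> still have size \<open>omega1\<close> and
  inject into \<open>\<A>\<close>. Passing to their image \<open>\<B>\<close> keeps the number of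
  dense sets within reach of the axiom.\<close>

lemma uncountable_three_colouring:
  assumes "uncountable \<A>"
  obtains \<B> and c :: "'a \<Rightarrow> nat" where "\<B> \<subseteq> \<A>" "|\<B>| \<le>o omega1" "c ` \<B> \<subseteq> {..<3}"
    "\<forall>i<3. uncountable {A \<in> \<B>. c A = i}"
proof -
  let ?W = "Field omega1"
  have W: "|?W| \<le>o omega1" "omega1 \<le>o |?W|"
    using card_of_Field_ordIso[OF omega1_Card_order] by (simp_all add: ordIso_iff_ordLeq)
  then have unc: "uncountable ?W"
    by (simp add: uncountable_iff_omega1_le)
  have "|{..<3 :: nat}| \<le>o omega1"
    using ordLeq_transitive[OF card_of_mono1[OF subset_UNIV] nat_le_omega1] .
  then have W3: "|?W \<times> {..<3 :: nat}| \<le>o omega1"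
    using card_of_Times_ordLeq_infinite_Field[OF omega1_infinite W(1) _ omega1_Card_order] by blast
  then have "|?W \<times> {..<3 :: nat}| \<le>o |\<A>|"
    using assms ordLeq_transitive unfolding uncountable_iff_omega1_le by blast
  then obtain g where g: "inj_on g (?W \<times> {..<3 :: nat})" "g ` (?W \<times> {..<3}) \<subseteq> \<A>"
    by (auto simp flip: card_of_ordLeq)
  define \<B> where "\<B> = g ` (?W \<times> {..<3})"
  \<comment> \<open>The colour is the index of the copy; off \<open>\<B>\<close> the value is
    arbitrary.\<close>
  define c where "c = snd \<circ> inv_into (?W \<times> {..<3}) g"
  have c: "c (g (x, i)) = i" if "x \<in> ?W" "i < 3" for x i
    using that by (simp add: c_def inv_into_f_f[OF g(1)])
  have "uncountable {A \<in> \<B>. c A = i}" if i: "i < 3" for i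
  proof -
    have "inj_on (\<lambda>x. g (x, i)) ?W" using g(1) i by (auto simp: inj_on_def)
    then have "uncountable ((\<lambda>x. g (x, i)) ` ?W)" using unc countable_image_inj_on by blast
    moreover have "(\<lambda>x. g (x, i)) ` ?W \<subseteq> {A \<in> \<B>. c A = i}" using i c by (auto simp: \<B>_def)
    ultimately show ?thesis using countable_subset by blast
  qed
  moreover have "|\<B>| \<le>o omega1" using ordLeq_transitive[OF card_of_image W3] by (simp add: \<B>_def)
  moreover have "c ` \<B> \<subseteq> {..<3}" using c by (auto simp: \<B>_def)
  ultimately show thesis using that[of \<B> c] g(2) by (simp add: \<B>_def)
qed

section \<open>Transfer to the topology\<close>

lemma MA_not_property_P3_Psi_space:
  assumes MA: "MA_omega1_sigma_linked" and ad: "almost_disjoint \<A>" and unc: "uncountable \<A>"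
  shows "\<not> property_P3 (Psi_space \<A>)"
proof -
  from uncountable_three_colouring[OF unc] obtain \<B> c where B:
    "\<B> \<subseteq> \<A>" "|\<B>| \<le>o omega1" "c ` \<B> \<subseteq> {..<3 :: nat}"
    "\<forall>i<3. uncountable {A \<in> \<B>. c A = i}" .
  have "almost_disjoint \<B>" using ad B(1) unfolding almost_disjoint_def by (meson subsetD)
  from MA_three_colour_separation[OF MA this B(2,3)] obtain V where
    V: "V 0 \<inter> V 1 \<inter> V 2 = {}" "\<forall>A\<in>\<B>. \<exists>n. A - {..<n} \<subseteq> V (c A)" .
  \<comment> \<open>Each \<open>U i\<close> is open because it contains a tail of each of its points
    \<open>A\<close>, and uncountable because of its colour class.\<close>
  define U where "U i = Inl ` V i \<union> Inr ` {A \<in> \<B>. c A = i}" for i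
  have "openin (Psi_space \<A>) (U i)" for i
  proof -
    have "\<exists>n. Psi_nhd A n \<subseteq> U i" if "Inr A \<in> U i" for A
    proof -
      have A: "A \<in> \<B>" "c A = i" using that by (auto simp: U_def)
      then obtain n where "A - {..<n} \<subseteq> V i" using V(2) by blast
      then have "Psi_nhd A n \<subseteq> U i" using A by (auto simp: Psi_nhd_def U_def)
      then show ?thesis ..
    qed
    then show ?thesis using B(1) by (auto simp: openin_Psi_space U_def)
  qed
  \<comment> \<open>Among the isolated points this is the separation; a point \<open>A\<close> has
    only one colour.\<close>
  moreover have "U 0 \<inter> U 1 \<inter> U 2 = {}" using V(1) by (auto simp: U_def)
  moreover have "uncountable (U i)" if "i < 3" for i
  proof -
    have "uncountable (Inr ` {A \<in> \<B>. c A = i} :: (nat + nat set) set)"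
      using B(4) that countable_image_inj_on[of Inr "{A \<in> \<B>. c A = i}"] by auto
    then show ?thesis unfolding U_def using countable_subset[OF Un_upper2] by blast
  qed
  then have "uncountable (U 0)" "uncountable (U 1)" "uncountable (U 2)" by simp_all
  ultimately show ?thesis
    unfolding property_P3_def by blast
qed

text \<open>Open sets of \<open>Y\<close> are pushed to \<open>X\<close>; injectivity preserves the
  empty intersection and reflects countability.\<close>

lemma property_P3_homeomorphic:
  assumes "X homeomorphic_space Y" and "property_P3 X"
  shows "property_P3 Y"
proof -
  obtain h where h: "homeomorphic_map Y X h"
    using assms(1) homeomorphic_space homeomorphic_space_sym by blast
  have inj: "inj_on h (topspace Y)" using h homeomorphic_imp_injective_map by blast
  have "countable U \<or> countable V \<or> countable W"
    if UVW: "openin Y U" "openin Y V" "openin Y W" "U \<inter> V \<inter> W = {}" for U V W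
  proof -
    have sub: "U \<subseteq> topspace Y" "V \<subseteq> topspace Y" "W \<subseteq> topspace Y"
      using UVW openin_subset by blast+
    then have "openin X (h ` U)" "openin X (h ` V)" "openin X (h ` W)"
      using UVW homeomorphic_map_openness[OF h] by blast+
    moreover have "h ` U \<inter> h ` V \<inter> h ` W = h ` (U \<inter> V \<inter> W)"
      using inj_on_image_Int[OF inj, of U V] inj_on_image_Int[OF inj, of "U \<inter> V" W] sub by auto
    ultimately have "countable (h ` U) \<or> countable (h ` V) \<or> countable (h ` W)"
      using assms(2) UVW(4) unfolding property_P3_def by (metis image_empty)
    then show ?thesis
      using countable_image_inj_on inj_on_subset[OF inj] sub by blast
  qed
  moreover have "Hausdorff_space Y"
    using assms homeomorphic_Hausdorff_space unfolding property_P3_def by blast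
  ultimately show ?thesis unfolding property_P3_def by meson
qed

theorem theorem3p1:
  assumes "MA_omega1_sigma_linked"
  shows "\<not> (\<exists>X :: 'a topology. uncountable (topspace X) \<and> Psi_like X \<and> property_P3 X)"
proof
  assume "\<exists>X :: 'a topology. uncountable (topspace X) \<and> Psi_like X \<and> property_P3 X"
  then obtain X :: "'a topology" and \<A> where X: "uncountable (topspace X)" "property_P3 X"
      "almost_disjoint \<A>" "X homeomorphic_space Psi_space \<A>"
    unfolding Psi_like_def by blast
  obtain h where "homeomorphic_map X (Psi_space \<A>) h"
    using X(4) homeomorphic_space by blast
  then have "inj_on h (topspace X)" "h ` topspace X = range Inl \<union> Inr ` \<A>"
    using homeomorphic_imp_injective_map homeomorphic_imp_surjective_map topspace_Psi_space
    by blast+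
  \<comment> \<open>The isolated points are countable, so the uncountability of \<open>X\<close>
    must come from \<open>\<A>\<close>.\<close>
  then have "uncountable \<A>"
    using X(1) countable_image_inj_on[of h "topspace X"] by auto
  then show False
    using MA_not_property_P3_Psi_space[OF assms X(3)] property_P3_homeomorphic[OF X(4,2)] by blast
qed

end
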